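(* For any $t>0$ and all $\gamma\in\Gamma$, $\mathcal I_t\,\pi_t(\gamma)=\pi_{-t}(\gamma)\,\mathcal I_t$ on $L^2(\partial X,\nu_o)$.
   Context: Setting. $(X,d)$ is a proper metric space with basepoint $o$; the Gromov product is $(x,y)_p=\frac12(d(x,p)+d(y,p)-d(x,y))$. It is assumed that $(X,d)$ is: $\delta$-hyperbolic (for some $\delta\ge0$, $(x,y)_o\ge\min\{(x,z)_o,(z,y)_o\}-\delta$ for all $x,y,z$); roughly geodesic (there is $C_X>0$ such that any $x,y\in X$ are joined by a map $r:[a,b]\to X$, $r(a)=x$, $r(b)=y$, with $|t-s|-C_X\le d(r(t),r(s))\le|t-s|+C_X$); and $\epsilon$-good for some $\epsilon>0$ (for every basepoint $p$ the Gromov product $(\cdot,\cdot)_p$ extends continuously to $\overline X=X\cup\partial X$, where $\partial X$ is the Gromov boundary, and $d_{p,\epsilon}(\xi,\eta)=e^{-\epsilon(\xi,\eta)_p}$ is a metric on $\partial X$). $\Gamma$ is a non-elementary Gromov hyperbolic group acting on $X$ by isometries, properly discontinuously and cocompactly. $Q=\limsup_{r\to\infty}\frac1r\log|\Gamma o\cap B(o,r)|$, $D=Q/\epsilon$, and $\nu_o$ is the $D$-dimensional Hausdorff measure of $(\partial X,d_{o,\epsilon})$ normalized to be a probability. It is $\Gamma$-quasi-invariant, with $\frac{d\gamma_*\nu_o}{d\nu_o}(\xi)=e^{Q\beta_\xi(o,\gamma o)}$, where $\beta_\xi(x,y)=\lim_{z\to\xi}(d(x,z)-d(z,y))$. For $t\in\mathbb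 R$, $\gamma\in\Gamma$, $v\in L^2(\partial X,\nu_o)$: $(\pi_t(\gamma)v)(\xi)=\big(\frac{d\gamma_*\nu_o}{d\nu_o}(\xi)\big)^{\frac12+t}v(\gamma^{-1}\xi)$. For $t>0$: $\mathcal I_t(v)(\xi)=\int_{\partial X}\frac{v(\eta)}{d_{o,\epsilon}(\xi,\eta)^{(1-2t)D}}d\nu_o(\eta)$. *)

theory Defs
  imports "HOL-Analysis.Analysis" "HOL-Algebra.Group_Action" "HOL-Algebra.Generated_Groups"
begin

section \<open>Gromov products, hyperbolic spaces and hyperbolic groups\<close>

definition gromov_product :: "('b \<Rightarrow> 'b \<Rightarrow> real) \<Rightarrow> 'b \<Rightarrow> 'b \<Rightarrow> 'b \<Rightarrow> real" where
  "gromov_product d p x y = (d x p + d y p - d x y) / 2"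

definition hyperbolic_at :: "'b set \<Rightarrow> ('b \<Rightarrow> 'b \<Rightarrow> real) \<Rightarrow> 'b \<Rightarrow> bool" where
  "hyperbolic_at M d p \<longleftrightarrow>
     (\<exists>\<delta>\<ge>0. \<forall>x\<in>M. \<forall>y\<in>M. \<forall>z\<in>M.
        gromov_product d p x y \<ge> min (gromov_product d p x z) (gromov_product d p z y) - \<delta>)"

definition roughly_geodesic :: "'b set \<Rightarrow> ('b \<Rightarrow> 'b \<Rightarrow> real) \<Rightarrow> bool" where
  "roughly_geodesic M d \<longleftrightarrow>
     (\<exists>C>0. \<forall>x\<in>M. \<forall>y\<in>M. \<exists>a b. \<exists>r :: real \<Rightarrow> 'b.
        a \<le> b \<and> r ` {a..b} \<subseteq> M \<and> r a = x \<and> r b = y \<and>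
        (\<forall>s\<in>{a..b}. \<forall>t\<in>{a..b}. \<bar>t - s\<bar> - C \<le> d (r t) (r s) \<and> d (r t) (r s) \<le> \<bar>t - s\<bar> + C))"

definition word_length :: "('g, 'm) monoid_scheme \<Rightarrow> 'g set \<Rightarrow> 'g \<Rightarrow> nat" where
  "word_length G S g =
     (LEAST n. \<exists>ws. length ws = n \<and> set ws \<subseteq> S \<union> m_inv G ` S \<and>
        foldr (mult G) ws \<one>\<^bsub>G\<^esub> = g)"

definition word_dist :: "('g, 'm) monoid_scheme \<Rightarrow> 'g set \<Rightarrow> 'g \<Rightarrow> 'g \<Rightarrow> real" where
  "word_dist G S g h = real (word_length G S (inv\<^bsub>G\<^esub> g \<otimes>\<^bsub>G\<^esub> h))"

definition hyperbolic_group :: "('g, 'm) monoid_scheme \<Rightarrow> bool" where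
  "hyperbolic_group G \<longleftrightarrow> group G \<and>
     (\<exists>S. finite S \<and> S \<subseteq> carrier G \<and> generate G S = carrier G \<and>
        hyperbolic_at (carrier G) (word_dist G S) \<one>\<^bsub>G\<^esub>)"

text \<open>Elementary means virtually cyclic; the trivial cyclic subgroup is allowed, so finite
  groups are elementary.\<close>

definition non_elementary :: "('g, 'm) monoid_scheme \<Rightarrow> bool" where
  "non_elementary G \<longleftrightarrow> (\<forall>a\<in>carrier G. infinite (rcosets\<^bsub>G\<^esub> (generate G {a})))"

section \<open>Isometric actions\<close>

definition geometric_action :: "('g, 'm) monoid_scheme \<Rightarrow> ('g \<Rightarrow> 'a::metric_space \<Rightarrow> 'a) \<Rightarrow> bool" where
  "geometric_action G \<phi> \<longleftrightarrow> group_action G UNIV \<phi> \<and>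
     (\<forall>g\<in>carrier G. \<forall>x y. dist (\<phi> g x) (\<phi> g y) = dist x y) \<and>
     (\<forall>K. compact K \<longrightarrow> finite {g \<in> carrier G. \<phi> g ` K \<inter> K \<noteq> {}}) \<and>
     (\<exists>K. compact K \<and> (\<Union>g\<in>carrier G. \<phi> g ` K) = UNIV)"

definition growth_exponent ::
    "('g, 'm) monoid_scheme \<Rightarrow> ('g \<Rightarrow> 'a::metric_space \<Rightarrow> 'a) \<Rightarrow> 'a \<Rightarrow> real" where
  "growth_exponent G \<phi> x0 =
     real_of_ereal (Limsup at_top (\<lambda>r::real. ereal (ln (real (card (orbit G \<phi> x0 \<inter> ball x0 r))) / r)))"

section \<open>The Gromov boundary and the bordification\<close>

definition asymptotic :: "'a::metric_space \<Rightarrow> (nat \<Rightarrow> 'a) \<Rightarrow> (nat \<Rightarrow> 'a) \<Rightarrow> bool" where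
  "asymptotic x0 s t \<longleftrightarrow>
     filterlim (\<lambda>(i, j). gromov_product dist x0 (s i) (t j)) at_top (sequentially \<times>\<^sub>F sequentially)"

definition gromov_sequences :: "'a::metric_space \<Rightarrow> (nat \<Rightarrow> 'a) set" where
  "gromov_sequences x0 = {s. asymptotic x0 s s}"

definition gromov_boundary :: "'a::metric_space \<Rightarrow> (nat \<Rightarrow> 'a) set set" where
  "gromov_boundary x0 =
     gromov_sequences x0 //
       {(s, t). s \<in> gromov_sequences x0 \<and> t \<in> gromov_sequences x0 \<and> asymptotic x0 s t}"

text \<open>The bordification is the disjoint union of the space (tagged \<open>Inl\<close>) and its boundary
  (tagged \<open>Inr\<close>).\<close>

definition bordification :: "'a::metric_space \<Rightarrow> ('a + (nat \<Rightarrow> 'a) set) set" where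
  "bordification x0 = UNIV <+> gromov_boundary x0"

primrec approximants :: "'a + (nat \<Rightarrow> 'a) set \<Rightarrow> (nat \<Rightarrow> 'a) set" where
  "approximants (Inl x) = {\<lambda>_. x}"
| "approximants (Inr \<xi>) = \<xi>"

text \<open>The supremum of the lower limits of the Gromov products along all approximating sequences.
  It makes sense in every hyperbolic space and serves only to define the topology of the
  bordification: the sets \<open>{b. R < rough_product x0 (Inr \<xi>) b}\<close> are the usual basic
  neighbourhoods of a boundary point \<open>\<xi>\<close>.\<close>

definition rough_product ::
    "'a::metric_space \<Rightarrow> 'a + (nat \<Rightarrow> 'a) set \<Rightarrow> 'a + (nat \<Rightarrow> 'a) set \<Rightarrow> ereal" where
  "rough_product x0 a b =
     (SUP s\<in>approximants a. SUP t\<in>approximants b.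
        Liminf (sequentially \<times>\<^sub>F sequentially)
          (\<lambda>(i, j). ereal (gromov_product dist x0 (s i) (t j))))"

definition bordification_open :: "'a::metric_space \<Rightarrow> ('a + (nat \<Rightarrow> 'a) set) set \<Rightarrow> bool" where
  "bordification_open x0 U \<longleftrightarrow> U \<subseteq> bordification x0 \<and> open (Inl -` U) \<and>
     (\<forall>\<xi>. Inr \<xi> \<in> U \<longrightarrow>
        (\<exists>R::real. {b \<in> bordification x0. ereal R < rough_product x0 (Inr \<xi>) b} \<subseteq> U))"

definition bordification_topology :: "'a::metric_space \<Rightarrow> ('a + (nat \<Rightarrow> 'a) set) topology" where
  "bordification_topology x0 = topology (bordification_open x0)"

lemma istopology_bordification_open: "istopology (bordification_open x0)"
  unfolding istopology_def
proof (intro conjI allI impI)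
  fix S T assume S: "bordification_open x0 S" and T: "bordification_open x0 T"
  show "bordification_open x0 (S \<inter> T)"
    unfolding bordification_open_def
  proof (intro conjI allI impI)
    show "S \<inter> T \<subseteq> bordification x0" using S by (auto simp: bordification_open_def)
    show "open (Inl -` (S \<inter> T))" using S T by (auto simp: bordification_open_def)
    fix \<xi> assume "Inr \<xi> \<in> S \<inter> T"
    then obtain R1 R2 :: real where
      "{b \<in> bordification x0. ereal R1 < rough_product x0 (Inr \<xi>) b} \<subseteq> S"
      "{b \<in> bordification x0. ereal R2 < rough_product x0 (Inr \<xi>) b} \<subseteq> T"
      using S T unfolding bordification_open_def by (meson IntE)
    moreover have "ereal R1 < c \<and> ereal R2 < c" if "ereal (max R1 R2) < c" for c
      using that by (metis ereal_less_eq(3) le_less_trans max.cobounded1 max.cobounded2)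
    ultimately have "{b \<in> bordification x0. ereal (max R1 R2) < rough_product x0 (Inr \<xi>) b} \<subseteq> S \<inter> T"
      by blast
    then show "\<exists>R::real. {b \<in> bordification x0. ereal R < rough_product x0 (Inr \<xi>) b} \<subseteq> S \<inter> T"
      by blast
  qed
next
  fix \<K> :: "('a + (nat \<Rightarrow> 'a) set) set set"
  assume K: "\<forall>K\<in>\<K>. bordification_open x0 K"
  show "bordification_open x0 (\<Union>\<K>)"
    unfolding bordification_open_def
  proof (intro conjI allI impI)
    show "\<Union>\<K> \<subseteq> bordification x0" using K by (auto simp: bordification_open_def)
    show "open (Inl -` \<Union>\<K>)" using K by (auto simp: bordification_open_def vimage_Union)
    fix \<xi> assume "Inr \<xi> \<in> \<Union>\<K>"
    then show "\<exists>R::real. {b \<in> bordification x0. ereal R < rough_product x0 (Inr \<xi>) b} \<subseteq> \<Union>\<K>"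
      using K unfolding bordification_open_def by (meson Sup_upper UnionE subset_trans)
  qed
qed

lemma openin_bordification_topology:
  "openin (bordification_topology x0) U \<longleftrightarrow> bordification_open x0 U"
  by (simp add: bordification_topology_def istopology_bordification_open)

text \<open>Here \<open>x0\<close> is the basepoint used to construct the bordification, and \<open>p\<close> the one of the Gromov
  product being extended. Since the space is dense in its bordification, the extension is unique on
  the bordification.\<close>

definition continuous_extension ::
    "'a::metric_space \<Rightarrow> 'a \<Rightarrow> ('a + (nat \<Rightarrow> 'a) set \<Rightarrow> 'a + (nat \<Rightarrow> 'a) set \<Rightarrow> ereal) \<Rightarrow> bool" where
  "continuous_extension x0 p F \<longleftrightarrow>
     continuous_map (prod_topology (bordification_topology x0) (bordification_topology x0))
       euclidean (\<lambda>(a, b). F a b) \<and>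
     (\<forall>x y. F (Inl x) (Inl y) = ereal (gromov_product dist p x y))"

definition extended_product ::
    "'a::metric_space \<Rightarrow> 'a \<Rightarrow> 'a + (nat \<Rightarrow> 'a) set \<Rightarrow> 'a + (nat \<Rightarrow> 'a) set \<Rightarrow> ereal" where
  "extended_product x0 p = (SOME F. continuous_extension x0 p F)"

text \<open>The value \<open>0\<close> off the boundary is needed because \<open>Metric_space\<close> demands nonnegativity and
  symmetry on the whole type.\<close>

definition visual_dist ::
    "'a::metric_space \<Rightarrow> 'a \<Rightarrow> real \<Rightarrow> (nat \<Rightarrow> 'a) set \<Rightarrow> (nat \<Rightarrow> 'a) set \<Rightarrow> real" where
  "visual_dist x0 p \<epsilon> \<xi> \<eta> =
     (if \<xi> \<in> gromov_boundary x0 \<and> \<eta> \<in> gromov_boundary x0 \<and>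
         extended_product x0 p (Inr \<xi>) (Inr \<eta>) \<noteq> \<infinity>
      then exp (- \<epsilon> * real_of_ereal (extended_product x0 p (Inr \<xi>) (Inr \<eta>))) else 0)"

definition good_space :: "'a::metric_space \<Rightarrow> real \<Rightarrow> bool" where
  "good_space x0 \<epsilon> \<longleftrightarrow>
     (\<forall>p. (\<exists>F. continuous_extension x0 p F) \<and> Metric_space (gromov_boundary x0) (visual_dist x0 p \<epsilon>))"

definition boundary_action :: "('a \<Rightarrow> 'a) \<Rightarrow> (nat \<Rightarrow> 'a) set \<Rightarrow> (nat \<Rightarrow> 'a) set" where
  "boundary_action f \<xi> = (\<lambda>s. f \<circ> s) ` \<xi>"

section \<open>Hausdorff measure\<close>

definition ediameter :: "('b \<Rightarrow> 'b \<Rightarrow> real) \<Rightarrow> 'b set \<Rightarrow> ennreal" where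
  "ediameter d U = (SUP x\<in>U. SUP y\<in>U. ennreal (d x y))"

text \<open>The weight \<open>diam(U)\<^sup>s\<close>, with the conventions \<open>diam({})\<^sup>s = 0\<close>, and \<open>0\<^sup>0 = 1\<close> for nonempty sets.
  It is only used for sets of finite diameter.\<close>

definition hausdorff_weight :: "('b \<Rightarrow> 'b \<Rightarrow> real) \<Rightarrow> real \<Rightarrow> 'b set \<Rightarrow> ennreal" where
  "hausdorff_weight d s U =
     (if U = {} then 0 else if s = 0 then 1 else ennreal (enn2real (ediameter d U) powr s))"

definition hausdorff_outer :: "'b set \<Rightarrow> ('b \<Rightarrow> 'b \<Rightarrow> real) \<Rightarrow> real \<Rightarrow> 'b set \<Rightarrow> ennreal" where
  "hausdorff_outer M d s A =
     (SUP \<delta>\<in>{0::real<..}.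
        INF U\<in>{U :: nat \<Rightarrow> 'b set. A \<subseteq> (\<Union>i. U i) \<and>
                  (\<forall>i. U i \<subseteq> M \<and> ediameter d (U i) \<le> ennreal \<delta>)}.
          suminf (\<lambda>i. hausdorff_weight d s (U i)))"

definition hausdorff_measure :: "'b set \<Rightarrow> ('b \<Rightarrow> 'b \<Rightarrow> real) \<Rightarrow> real \<Rightarrow> 'b measure" where
  "hausdorff_measure M d s =
     measure_of M {U. openin (Metric_space.mtopology M d) U} (hausdorff_outer M d s)"

section \<open>The boundary representations and the intertwining integral\<close>

definition conformal_dim ::
    "('g, 'm) monoid_scheme \<Rightarrow> ('g \<Rightarrow> 'a::metric_space \<Rightarrow> 'a) \<Rightarrow> 'a \<Rightarrow> real \<Rightarrow> real" where
  "conformal_dim G \<phi> x0 \<epsilon> = growth_exponent G \<phi> x0 / \<epsilon>"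

text \<open>In the setting considered here the total Hausdorff mass is positive and finite (Coornaert), so
  the normalization yields a probability measure.\<close>

definition boundary_measure ::
    "('g, 'm) monoid_scheme \<Rightarrow> ('g \<Rightarrow> 'a::metric_space \<Rightarrow> 'a) \<Rightarrow> 'a \<Rightarrow> real \<Rightarrow> (nat \<Rightarrow> 'a) set measure" where
  "boundary_measure G \<phi> x0 \<epsilon> =
     uniform_measure
       (hausdorff_measure (gromov_boundary x0) (visual_dist x0 x0 \<epsilon>) (conformal_dim G \<phi> x0 \<epsilon>))
       (gromov_boundary x0)"

definition square_integrable :: "'b measure \<Rightarrow> ('b \<Rightarrow> complex) \<Rightarrow> bool" where
  "square_integrable M v \<longleftrightarrow> v \<in> borel_measurable M \<and> integrable M (\<lambda>x. (cmod (v x))\<^sup>2)"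

definition boundary_rep ::
    "('g, 'm) monoid_scheme \<Rightarrow> ('g \<Rightarrow> 'a::metric_space \<Rightarrow> 'a) \<Rightarrow> 'a \<Rightarrow> real \<Rightarrow> real \<Rightarrow> 'g \<Rightarrow>
      ((nat \<Rightarrow> 'a) set \<Rightarrow> complex) \<Rightarrow> (nat \<Rightarrow> 'a) set \<Rightarrow> complex" where
  "boundary_rep G \<phi> x0 \<epsilon> t g v \<xi> =
     (let \<nu> = boundary_measure G \<phi> x0 \<epsilon>
      in of_real (enn2real (RN_deriv \<nu> (distr \<nu> \<nu> (boundary_action (\<phi> g))) \<xi>) powr (1/2 + t)) *
         v (boundary_action (\<phi> (inv\<^bsub>G\<^esub> g)) \<xi>))"

text \<open>At \<open>\<eta> = \<xi>\<close> the integrand is \<open>0\<close>, because \<open>0 powr a = 0\<close> and \<open>x / 0 = 0\<close>; points are null sets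
  of the boundary measure.\<close>

definition intertwiner ::
    "('g, 'm) monoid_scheme \<Rightarrow> ('g \<Rightarrow> 'a::metric_space \<Rightarrow> 'a) \<Rightarrow> 'a \<Rightarrow> real \<Rightarrow> real \<Rightarrow>
      ((nat \<Rightarrow> 'a) set \<Rightarrow> complex) \<Rightarrow> (nat \<Rightarrow> 'a) set \<Rightarrow> complex" where
  "intertwiner G \<phi> x0 \<epsilon> t v \<xi> =
     (LINT \<eta>|boundary_measure G \<phi> x0 \<epsilon>.
        v \<eta> / of_real (visual_dist x0 x0 \<epsilon> \<xi> \<eta> powr ((1 - 2 * t) * conformal_dim G \<phi> x0 \<epsilon>)))"

end

theory Submission
  imports Defs "HOL-Probability.Probability_Measure"
begin

text \<open>The relation is a change of variables, governed by the conformality of the boundary action.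
  Let \<open>o\<close> be the basepoint, \<open>S\<close> the action of the inverse of \<open>g\<close> on the boundary, \<open>T\<close> the action of
  \<open>g\<close>, and \<open>\<beta>\<^sub>\<xi>\<close> the Busemann cocycle \<open>\<beta>\<^sub>\<xi>(o, g o)\<close>. For points of the space, replacing the basepoint
  \<open>o\<close> of a Gromov product by \<open>g o\<close> changes it by a sum of two terms, each depending on only one of the
  points. Continuity of the Gromov product on the bordification carries this over to the boundary
  and shows that visual distances satisfy
  \<open>d(S \<xi>, S \<eta>) = exp (\<epsilon> (\<beta>\<^sub>\<xi> + \<beta>\<^sub>\<eta>) / 2) d(\<xi>, \<eta>)\<close> exactly (\<open>visual_dist_boundary_action\<close>).

  Such a bijection transforms \<open>D\<close>-dimensional Hausdorff measure by the density
  \<open>\<rho>(\<xi>) = exp (\<epsilon> D \<beta>\<^sub>\<xi>)\<close> (\<open>distr_hausdorff_measure\<close>): on sets where \<open>\<beta>\<close> is nearly constant it is nearly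
  a similarity. Hence \<open>\<rho>\<close> is the Radon-Nikodym derivative in the boundary representation. As the
  kernel \<open>d(\<xi>, \<eta>)\<close> to the power \<open>(1 - 2t) D\<close> is multiplied under \<open>S\<close> by the powers \<open>1/2 - t\<close> of
  \<open>\<rho>(\<xi>)\<close> and of \<open>\<rho>(\<eta>)\<close>, substituting \<open>S \<eta>\<close> for \<open>\<eta>\<close> turns one side of the claim into the other
  (\<open>riesz_potential_conformal\<close>).

  The degenerate cases are settled by conventions: if the total Hausdorff mass is \<open>0\<close> or infinite,
  the normalized measure is null and the claim holds vacuously. Otherwise Hausdorff measure
  coincides with the outer measure on Borel sets, where the Lipschitz estimates apply.\<close>

section \<open>Hausdorff measure and Lipschitz maps\<close>

lemma ennreal_mult_le_iff:
  assumes "0 < c"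
  shows "ennreal (1 / c) * a \<le> b \<longleftrightarrow> a \<le> ennreal c * b"
proof -
  have "ennreal (1 / c) * (ennreal c * x) = x" "ennreal c * (ennreal (1 / c) * x) = x" for x
    using assms by (simp_all add: mult.assoc[symmetric] ennreal_mult'[symmetric])
  then show ?thesis
    by (metis mult_left_mono zero_le)
qed

lemma ediameter_image_Lipschitz:
  assumes "\<And>x y. x \<in> U \<Longrightarrow> y \<in> U \<Longrightarrow> d (S x) (S y) \<le> L * d x y" and "0 \<le> L"
  shows "ediameter d (S ` U) \<le> ennreal L * ediameter d U"
  unfolding ediameter_def
proof (rule SUP_least, rule SUP_least)
  fix a b assume "a \<in> S ` U" "b \<in> S ` U"
  then obtain x y where xy: "x \<in> U" "y \<in> U" "a = S x" "b = S y" by blast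
  have "ennreal (d a b) \<le> ennreal (L * d x y)"
    using assms(1) xy by (simp add: ennreal_leI)
  also have "\<dots> = ennreal L * ennreal (d x y)"
    using assms(2) by (simp add: ennreal_mult')
  also have "\<dots> \<le> ennreal L * (SUP x\<in>U. SUP y\<in>U. ennreal (d x y))"
    by (intro mult_left_mono SUP_upper2[OF xy(1)] SUP_upper2[OF xy(2)]) auto
  finally show "ennreal (d a b) \<le> ennreal L * (SUP x\<in>U. SUP y\<in>U. ennreal (d x y))" .
qed

lemma ediameter_mono: "U \<subseteq> V \<Longrightarrow> ediameter d U \<le> ediameter d V"
  unfolding ediameter_def by (intro SUP_mono) (meson SUP_subset_mono order_refl subsetD)

lemma hausdorff_weight_image_Lipschitz:
  assumes "\<And>x y. x \<in> U \<Longrightarrow> y \<in> U \<Longrightarrow> d (S x) (S y) \<le> L * d x y"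
    and "0 < L" and "0 \<le> s" and "ediameter d U < \<infinity>"
  shows "hausdorff_weight d s (S ` U) \<le> ennreal (L powr s) * hausdorff_weight d s U"
proof -
  have "enn2real (ediameter d (S ` U)) \<le> enn2real (ennreal L * ediameter d U)"
    using assms ediameter_image_Lipschitz[of U d S L]
    by (intro enn2real_mono) (auto simp: ennreal_mult_less_top)
  also have "\<dots> = L * enn2real (ediameter d U)"
    using assms(2) by (simp add: enn2real_mult)
  finally have "enn2real (ediameter d (S ` U)) powr s \<le> (L * enn2real (ediameter d U)) powr s"
    using \<open>0 \<le> s\<close> by (intro powr_mono2) auto
  also have "\<dots> = L powr s * enn2real (ediameter d U) powr s"
    using assms(2) by (simp add: powr_mult)
  finally show ?thesis
    using assms(2)
    by (auto simp: hausdorff_weight_def ennreal_mult'[symmetric] intro!: ennreal_leI)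
qed

lemma hausdorff_weight_mono:
  assumes "U \<subseteq> V" "0 \<le> s" "ediameter d V < \<infinity>"
  shows "hausdorff_weight d s U \<le> hausdorff_weight d s V"
  using assms ediameter_mono[OF assms(1), of d]
  by (auto simp: hausdorff_weight_def intro!: ennreal_leI powr_mono2 enn2real_mono)

text \<open>The pieces of a cover of \<open>A\<close> may be cut down to \<open>A\<close> before they are pushed forward, so the
  Lipschitz bound is only needed on \<open>A\<close> itself, and the images again cover by subsets of \<open>M\<close>. This
  locality is what later allows a different constant on each level set of the conformal factor.\<close>
lemma hausdorff_outer_image_Lipschitz:
  assumes lip: "\<And>x y. x \<in> A \<Longrightarrow> y \<in> A \<Longrightarrow> d (S x) (S y) \<le> L * d x y"
    and "0 < L" and "0 \<le> s" and "S ` A \<subseteq> M"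
  shows "hausdorff_outer M d s (S ` A) \<le> ennreal (L powr s) * hausdorff_outer M d s A"
  unfolding hausdorff_outer_def
proof (rule SUP_least)
  let ?cov = "\<lambda>A \<delta>. {U :: nat \<Rightarrow> 'a set. A \<subseteq> (\<Union>i. U i) \<and>
    (\<forall>i. U i \<subseteq> M \<and> ediameter d (U i) \<le> ennreal \<delta>)}"
  let ?m = "\<lambda>A \<delta>. INF U\<in>?cov A \<delta>. \<Sum>i. hausdorff_weight d s (U i)"
  fix \<delta> :: real assume "\<delta> \<in> {0<..}"
  then have "\<delta> / L > 0" using \<open>0 < L\<close> by simp
  have c: "0 < L powr s" using \<open>0 < L\<close> by simp
  have "?m (S ` A) \<delta> \<le> (\<Sum>i. ennreal (L powr s) * hausdorff_weight d s (U i))"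
    if U: "U \<in> ?cov A (\<delta> / L)" for U
  proof (rule INF_lower2)
    let ?V = "\<lambda>i. S ` (U i \<inter> A)"
    have fin: "ediameter d (U i) < \<infinity>" for i
      using U by (auto intro: le_less_trans)
    have "ediameter d (?V i) \<le> ennreal \<delta>" for i
    proof -
      have "ediameter d (?V i) \<le> ennreal L * ediameter d (U i \<inter> A)"
        using lip \<open>0 < L\<close> by (intro ediameter_image_Lipschitz) auto
      also have "\<dots> \<le> ennreal L * ennreal (\<delta> / L)"
        using U by (intro mult_left_mono order_trans[OF ediameter_mono[of "U i \<inter> A" "U i"]]) auto
      also have "\<dots> = ennreal \<delta>"
        using \<open>0 < L\<close> \<open>\<delta> / L > 0\<close> by (simp add: ennreal_mult'[symmetric])
      finally show ?thesis .
    qed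
    then show "?V \<in> ?cov (S ` A) \<delta>" using U \<open>S ` A \<subseteq> M\<close> by blast
    show "(\<Sum>i. hausdorff_weight d s (?V i)) \<le> (\<Sum>i. ennreal (L powr s) * hausdorff_weight d s (U i))"
    proof (rule suminf_le)
      fix i
      have "hausdorff_weight d s (?V i) \<le> ennreal (L powr s) * hausdorff_weight d s (U i \<inter> A)"
        using lip assms(2,3) fin[of i] ediameter_mono[of "U i \<inter> A" "U i" d]
        by (intro hausdorff_weight_image_Lipschitz) (auto intro: le_less_trans)
      also have "\<dots> \<le> ennreal (L powr s) * hausdorff_weight d s (U i)"
        using assms(3) fin by (intro mult_left_mono hausdorff_weight_mono) auto
      finally show "hausdorff_weight d s (?V i) \<le> ennreal (L powr s) * hausdorff_weight d s (U i)" .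
    qed auto
  qed
  then have "ennreal (1 / L powr s) * ?m (S ` A) \<delta> \<le> ?m A (\<delta> / L)"
    using c by (intro INF_greatest) (simp only: ennreal_mult_le_iff ennreal_suminf_cmult)
  then have "?m (S ` A) \<delta> \<le> ennreal (L powr s) * ?m A (\<delta> / L)"
    using c by (simp only: ennreal_mult_le_iff)
  also have "\<dots> \<le> ennreal (L powr s) * (SUP \<delta>\<in>{0<..}. ?m A \<delta>)"
    using \<open>\<delta> / L > 0\<close> by (intro mult_left_mono SUP_upper) auto
  finally show "?m (S ` A) \<delta> \<le> ennreal (L powr s) * (SUP \<delta>\<in>{0<..}. ?m A \<delta>)" .
qed

lemma space_hausdorff_measure [simp]: "space (hausdorff_measure M d s) = M"
  by (simp add: hausdorff_measure_def space_measure_of_conv)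

lemma sets_hausdorff_measure:
  assumes "Metric_space M d"
  shows "sets (hausdorff_measure M d s) = sigma_sets M {U. openin (Metric_space.mtopology M d) U}"
  unfolding hausdorff_measure_def
  using openin_subset[of "Metric_space.mtopology M d"] Metric_space.topspace_mtopology[OF assms]
  by (intro sets_measure_of) auto

text \<open>A measure generated by an outer measure that fails to be countably additive is the null
  measure. So as soon as the whole space has nonzero mass, countable additivity holds and the
  measure agrees with the outer measure on Borel sets.\<close>
lemma emeasure_hausdorff_measure:
  assumes "emeasure (hausdorff_measure M d s) M \<noteq> 0" and "A \<in> sets (hausdorff_measure M d s)"
  shows "emeasure (hausdorff_measure M d s) A = hausdorff_outer M d s A"
  using assms unfolding hausdorff_measure_def
  by (auto simp: emeasure_measure_of_conv sets_measure_of_conv split: if_splits)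

section \<open>Comparison of measures\<close>

lemma ennreal_le_if_le_exp_mult:
  fixes a b :: ennreal
  assumes "\<And>\<tau>. 0 < \<tau> \<Longrightarrow> a \<le> ennreal (exp (s * \<tau>)) * b"
  shows "a \<le> b"
proof (cases "b = \<infinity>")
  case False
  have "(\<lambda>k. s * inverse (real (Suc k))) \<longlonglongrightarrow> s * 0"
    by (intro tendsto_mult_left LIMSEQ_inverse_real_of_nat)
  then have "(\<lambda>k. ennreal (exp (s * inverse (real (Suc k))))) \<longlonglongrightarrow> ennreal (exp (s * 0))"
    by (intro tendsto_ennrealI tendsto_exp)
  then have "(\<lambda>k. b * ennreal (exp (s * inverse (real (Suc k))))) \<longlonglongrightarrow> b * ennreal (exp (s * 0))"
    using False by (intro ennreal_tendsto_cmult) (auto simp: less_top)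
  then have "a \<le> b * ennreal (exp (s * 0))"
    using assms[of "inverse (real (Suc _))"]
    by (intro LIMSEQ_le_const) (auto simp: mult.commute)
  then show ?thesis by simp
qed simp

text \<open>Both sides are sums over the countably many disjoint pieces that the level sets of \<open>n\<close> cut out
  of \<open>A\<close>.\<close>
lemma emeasure_le_by_pieces:
  fixes n :: "'b \<Rightarrow> 'i::countable"
  assumes sets: "sets N = sets P" and n: "n \<in> measurable P (count_space UNIV)"
    and le: "\<And>i B. B \<in> sets P \<Longrightarrow> (\<And>x. x \<in> B \<Longrightarrow> n x = i) \<Longrightarrow> emeasure N B \<le> c * emeasure P B"
    and A: "A \<in> sets P"
  shows "emeasure N A \<le> c * emeasure P A"
proof -
  define B where "B i = A \<inter> (n -` {i} \<inter> space P)" for i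
  have B: "B i \<in> sets P" for i
    unfolding B_def using n A by measurable
  have disj: "disjoint_family B"
    by (auto simp: disjoint_family_on_def B_def)
  have UN: "A = (\<Union>i. B i)"
    using sets.sets_into_space[OF A] by (auto simp: B_def)
  have sum: "emeasure Q A = (\<integral>\<^sup>+i. emeasure Q (B i) \<partial>count_space UNIV)" if "sets Q = sets P" for Q
    unfolding UN using B disj that by (intro emeasure_UN_countable) auto
  have "emeasure N A \<le> (\<integral>\<^sup>+i. c * emeasure P (B i) \<partial>count_space UNIV)"
    unfolding sum[OF sets] using B by (intro nn_integral_mono le) (auto simp: B_def)
  also have "\<dots> = c * emeasure P A"
    unfolding sum[OF refl] by (simp add: nn_integral_cmult)
  finally show ?thesis .
qed

section \<open>Conformal bijections and the change of variables for Hausdorff measure\<close>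

lemma (in Metric_space) sets_hausdorff_measure_openin:
  "openin mtopology U \<Longrightarrow> U \<in> sets (hausdorff_measure M d s)"
  by (simp add: sets_hausdorff_measure[OF Metric_space_axioms] sigma_sets.Basic)

lemma (in Metric_space) sets_hausdorff_measure_singleton:
  assumes "a \<in> M" shows "{a} \<in> sets (hausdorff_measure M d s)"
proof -
  have "closedin mtopology {a}"
    using assms Hausdorff_space_mtopology by (intro closedin_Hausdorff_singleton) auto
  then have "M - (M - {a}) \<in> sets (hausdorff_measure M d s)"
    using sets.compl_sets[OF sets_hausdorff_measure_openin[of "M - {a}" s]]
    by (simp add: closedin_def)
  then show ?thesis using assms by (simp add: double_diff)
qed

lemma (in Metric_space) borel_measurable_dist_hausdorff_measure:
  assumes "a \<in> M" shows "(\<lambda>x. d a x) \<in> borel_measurable (hausdorff_measure M d s)"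
  unfolding borel_measurable_iff_less
proof
  fix r
  have "{x \<in> M. d a x < r} = mball a r"
    using assms by auto
  then show "{x \<in> space (hausdorff_measure M d s). d a x < r} \<in> sets (hausdorff_measure M d s)"
    using sets_hausdorff_measure_openin[OF openin_mball] by simp
qed

lemma (in Metric_space) Lipschitz_measurable_hausdorff_measure:
  assumes S: "\<And>x. x \<in> M \<Longrightarrow> S x \<in> M"
    and lip: "\<And>x y. x \<in> M \<Longrightarrow> y \<in> M \<Longrightarrow> d (S x) (S y) \<le> L * d x y" and "0 < L"
  shows "S \<in> measurable (hausdorff_measure M d s) (hausdorff_measure M d s)"
proof (rule measurable_sigma_sets[OF sets_hausdorff_measure[OF Metric_space_axioms]])
  show "{U. openin mtopology U} \<subseteq> Pow M"
    using openin_subset[of mtopology] by auto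
  show "S \<in> space (hausdorff_measure M d s) \<rightarrow> M"
    using S by simp
  fix U assume "U \<in> {U. openin mtopology U}"
  then have U: "\<And>x. x \<in> U \<Longrightarrow> \<exists>r>0. mball x r \<subseteq> U"
    by (simp add: openin_mtopology)
  have "openin mtopology (S -` U \<inter> M)"
    unfolding openin_mtopology
  proof (intro conjI allI impI)
    fix x assume x: "x \<in> S -` U \<inter> M"
    then obtain r where r: "r > 0" "mball (S x) r \<subseteq> U"
      using U by blast
    have "mball x (r / L) \<subseteq> S -` U \<inter> M"
    proof
      fix y assume y: "y \<in> mball x (r / L)"
      then have "L * d x y < r"
        using \<open>0 < L\<close> by (simp add: field_simps)
      then have "d (S x) (S y) < r"
        using lip[of x y] x y by simp
      then show "y \<in> S -` U \<inter> M"
        using r x y S by auto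
    qed
    then show "\<exists>r>0. mball x r \<subseteq> S -` U \<inter> M"
      using r \<open>0 < L\<close> by (intro exI[of _ "r / L"]) simp
  qed simp
  then show "S -` U \<inter> space (hausdorff_measure M d s) \<in> sets (hausdorff_measure M d s)"
    using sets_hausdorff_measure_openin by simp
qed

text \<open>In an ordinary metric a conformal map multiplies distances by the derivative only in the limit.
  Here distances are multiplied exactly by the geometric mean of the values \<open>exp (h x)\<close> and
  \<open>exp (h y)\<close> of the conformal factor, as visual metrics satisfy under isometries of a hyperbolic
  space. The map is \<open>S\<close>, its inverse is \<open>T\<close>, and boundedness of \<open>h\<close> makes both of them Lipschitz.\<close>
locale conformal_bijection = Metric_space M d
  for M :: "'b set" and d +
  fixes S T :: "'b \<Rightarrow> 'b" and h :: "'b \<Rightarrow> real" and K :: real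
  assumes S_in: "x \<in> M \<Longrightarrow> S x \<in> M" and T_in: "x \<in> M \<Longrightarrow> T x \<in> M"
    and S_T: "x \<in> M \<Longrightarrow> S (T x) = x" and T_S: "x \<in> M \<Longrightarrow> T (S x) = x"
    and bounded: "x \<in> M \<Longrightarrow> \<bar>h x\<bar> \<le> K"
    and conformal: "x \<in> M \<Longrightarrow> y \<in> M \<Longrightarrow> d (S x) (S y) = exp ((h x + h y) / 2) * d x y"
begin

abbreviation H :: "real \<Rightarrow> 'b measure" where "H s \<equiv> hausdorff_measure M d s"

lemma conformal_inverse:
  assumes "x \<in> M" "y \<in> M"
  shows "d (T x) (T y) = exp (- (h (T x) + h (T y)) / 2) * d x y"
  using conformal[of "T x" "T y"] assms
  by (simp add: T_in S_T mult.assoc[symmetric] exp_add[symmetric])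
     (simp add: field_simps flip: exp_add)

lemma S_measurable: "S \<in> measurable (H s) (H s)"
proof (rule Lipschitz_measurable_hausdorff_measure[OF S_in, where L = "exp K"])
  fix x y assume "x \<in> M" "y \<in> M"
  then show "d (S x) (S y) \<le> exp K * d x y"
    using bounded[of x] bounded[of y] by (auto simp: conformal intro!: mult_right_mono)
qed auto

lemma T_measurable: "T \<in> measurable (H s) (H s)"
proof (rule Lipschitz_measurable_hausdorff_measure[OF T_in, where L = "exp K"])
  fix x y assume "x \<in> M" "y \<in> M"
  then show "d (T x) (T y) \<le> exp K * d x y"
    using bounded[of "T x"] bounded[of "T y"]
    by (auto simp: conformal_inverse T_in intro!: mult_right_mono)
qed auto

text \<open>The conformal factor can be read off from the metric: fixing one point \<open>a\<close>, its value at every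
  other point \<open>x\<close> is determined by how \<open>S\<close> changes the distance from \<open>a\<close> to \<open>x\<close>. Hence it is a
  Borel function, because distances from a fixed point are.\<close>
lemma h_measurable: "h \<in> borel_measurable (H s)"
proof (cases "M = {}")
  case True
  then show ?thesis by (simp add: measurable_def)
next
  case False
  then obtain a where a: "a \<in> M" by blast
  note [measurable] = S_measurable[of s] borel_measurable_dist_hausdorff_measure[OF a, of s]
    borel_measurable_dist_hausdorff_measure[OF S_in[OF a], of s]
    sets_hausdorff_measure_singleton[OF a, of s]
  have "h x = (if x \<in> {a} then h a else 2 * ln (d (S a) (S x) / d a x) - h a)" if "x \<in> M" for x
  proof (cases "x = a")
    case False
    then have "d (S a) (S x) / d a x = exp ((h a + h x) / 2)"
      using a that by (simp add: conformal)
    then show ?thesis using False by (simp add: add_divide_distrib)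
  qed simp
  moreover have "(\<lambda>x. if x \<in> {a} then h a else 2 * ln (d (S a) (S x) / d a x) - h a) \<in> borel_measurable (H s)"
    by measurable
  ultimately show ?thesis
    by (subst measurable_cong) auto
qed

lemma vimage_T_eq_image_S: "B \<subseteq> M \<Longrightarrow> T -` B \<inter> M = S ` B"
  using S_in T_in S_T T_S by force

text \<open>On a set where \<open>h\<close> varies by at most \<open>\<tau>\<close>, the map \<open>S\<close> is a similarity up to the factor
  \<open>exp \<tau>\<close>, because the geometric mean of two values of the conformal factor lies between their
  extremes. The behaviour of Hausdorff measure under \<open>S\<close> and \<open>T\<close> therefore compares the two measures
  on that set up to \<open>exp (s * \<tau>)\<close>. The level sets of \<open>\<lfloor>h x / \<tau>\<rfloor>\<close> form a countable partition into
  such sets, so the comparison holds everywhere, and \<open>\<tau>\<close> tends to \<open>0\<close>.\<close>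
lemma distr_hausdorff_measure:
  assumes s: "0 \<le> s" and "emeasure (H s) M \<noteq> 0"
  shows "distr (H s) (H s) T = density (H s) (\<lambda>x. ennreal (exp (s * h x)))"
proof -
  note [measurable] = h_measurable[of s] T_measurable[of s]
  let ?N = "distr (H s) (H s) T" and ?P = "density (H s) (\<lambda>x. ennreal (exp (s * h x)))"
  have compare: "emeasure ?N B \<le> ennreal (exp (s * \<tau>)) * emeasure ?P B \<and>
      emeasure ?P B \<le> ennreal (exp (s * \<tau>)) * emeasure ?N B"
    if B[measurable]: "B \<in> sets (H s)" and level: "\<And>x. x \<in> B \<Longrightarrow> \<lfloor>h x / \<tau>\<rfloor> = n" and "0 < \<tau>"
    for B \<tau> and n :: int
  proof -
    define lo hi where "lo = of_int n * \<tau>" and "hi = (of_int n + 1) * \<tau>"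
    have BM: "B \<subseteq> M" using sets.sets_into_space[OF B] by simp
    have lo_hi: "lo \<le> h x" "h x \<le> hi" if "x \<in> B" for x
      using level[OF that] \<open>0 < \<tau>\<close> unfolding lo_def hi_def
      by (simp_all add: floor_eq_iff field_simps)
    have SB: "S ` B \<in> sets (H s)"
      using measurable_sets[OF T_measurable B] BM by (simp add: vimage_T_eq_image_S)
    have N: "emeasure ?N B = hausdorff_outer M d s (S ` B)"
      using BM SB assms(2) by (simp add: emeasure_distr vimage_T_eq_image_S emeasure_hausdorff_measure)
    have HB: "emeasure (H s) B = hausdorff_outer M d s B"
      using assms(2) B by (rule emeasure_hausdorff_measure)
    have P: "emeasure ?P B = (\<integral>\<^sup>+x. ennreal (exp (s * h x)) * indicator B x \<partial>H s)"
      by (intro emeasure_density) auto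
    have P_le: "emeasure ?P B \<le> ennreal (exp (s * hi)) * emeasure (H s) B"
      unfolding P using lo_hi s
      by (subst nn_integral_cmult_indicator[symmetric, OF B], intro nn_integral_mono)
         (auto simp: mult_left_mono intro!: ennreal_leI split: split_indicator)
    have le_P: "ennreal (exp (s * lo)) * emeasure (H s) B \<le> emeasure ?P B"
      unfolding P using lo_hi s
      by (subst nn_integral_cmult_indicator[symmetric, OF B], intro nn_integral_mono)
         (auto simp: mult_left_mono intro!: ennreal_leI split: split_indicator)
    have "hausdorff_outer M d s (S ` B) \<le> ennreal (exp hi powr s) * hausdorff_outer M d s B"
    proof (rule hausdorff_outer_image_Lipschitz)
      fix x y assume "x \<in> B" "y \<in> B"
      then show "d (S x) (S y) \<le> exp hi * d x y"
        using lo_hi[of x] lo_hi[of y] BM by (auto simp: conformal subsetD intro!: mult_right_mono)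
    qed (use BM S_in s in auto)
    then have N_le: "emeasure ?N B \<le> ennreal (exp (s * hi)) * emeasure (H s) B"
      unfolding N HB by (simp add: powr_def)
    have "hausdorff_outer M d s (T ` S ` B) \<le> ennreal (exp (- lo) powr s) * hausdorff_outer M d s (S ` B)"
    proof (rule hausdorff_outer_image_Lipschitz)
      fix x y assume "x \<in> S ` B" "y \<in> S ` B"
      then obtain x' y' where xy: "x' \<in> B" "y' \<in> B" "x = S x'" "y = S y'"
        by blast
      then have "x' \<in> M" "y' \<in> M" using BM by blast+
      with xy have "x \<in> M" "y \<in> M" "T x \<in> B" "T y \<in> B"
        by (simp_all add: S_in T_S)
      then show "d (T x) (T y) \<le> exp (- lo) * d x y"
        using lo_hi(1)[of "T x"] lo_hi(1)[of "T y"]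
        by (subst conformal_inverse) (simp_all add: mult_right_mono)
    qed (use BM T_in S_in s in auto)
    moreover have "T ` S ` B = B"
      using BM T_S by (force simp: image_image)
    ultimately have le_N: "emeasure (H s) B \<le> ennreal (exp (- s * lo)) * emeasure ?N B"
      unfolding N HB by (simp add: powr_def)
    have step: "exp (s * hi) = exp (s * \<tau>) * exp (s * lo)"
      by (simp add: hi_def lo_def algebra_simps flip: exp_add)
    have "emeasure ?N B \<le> ennreal (exp (s * \<tau>)) * (ennreal (exp (s * lo)) * emeasure (H s) B)"
      using N_le unfolding step by (simp add: ennreal_mult' mult.assoc)
    also have "\<dots> \<le> ennreal (exp (s * \<tau>)) * emeasure ?P B"
      using le_P by (intro mult_left_mono) auto
    finally have 1: "emeasure ?N B \<le> ennreal (exp (s * \<tau>)) * emeasure ?P B" .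
    have "emeasure ?P B \<le> ennreal (exp (s * hi)) * (ennreal (exp (- s * lo)) * emeasure ?N B)"
      using P_le le_N by (meson mult_left_mono order_trans zero_le)
    also have "\<dots> = ennreal (exp (s * \<tau>)) * emeasure ?N B"
      by (simp add: mult.assoc[symmetric] ennreal_mult'[symmetric] exp_add[symmetric])
         (simp add: hi_def lo_def algebra_simps)
    finally show ?thesis using 1 by simp
  qed
  have level_measurable: "(\<lambda>x. \<lfloor>h x / \<tau>\<rfloor>) \<in> measurable (H s) (count_space UNIV)" for \<tau>
    by measurable
  show ?thesis
  proof (rule measure_eqI)
    fix A assume "A \<in> sets ?N"
    then have A: "A \<in> sets (H s)" by simp
    have "emeasure ?N A \<le> ennreal (exp (s * \<tau>)) * emeasure ?P A"
      and "emeasure ?P A \<le> ennreal (exp (s * \<tau>)) * emeasure ?N A" if "0 < \<tau>" for \<tau>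
    proof -
      show "emeasure ?N A \<le> ennreal (exp (s * \<tau>)) * emeasure ?P A"
        by (rule emeasure_le_by_pieces[where n = "\<lambda>x. \<lfloor>h x / \<tau>\<rfloor>"])
           (use compare[OF _ _ that, THEN conjunct1] level_measurable A in simp_all)
      show "emeasure ?P A \<le> ennreal (exp (s * \<tau>)) * emeasure ?N A"
        by (rule emeasure_le_by_pieces[where n = "\<lambda>x. \<lfloor>h x / \<tau>\<rfloor>"])
           (use compare[OF _ _ that, THEN conjunct2] level_measurable A in simp_all)
    qed
    then show "emeasure ?N A = emeasure ?P A"
      by (meson antisym ennreal_le_if_le_exp_mult)
  qed simp
qed

lemma distr_uniform_measure:
  assumes s: "0 \<le> s" and "emeasure (H s) M \<noteq> 0"
  defines "\<nu> \<equiv> uniform_measure (H s) M"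
  shows "distr \<nu> \<nu> T = density \<nu> (\<lambda>x. ennreal (exp (s * h x)))"
proof (rule measure_eqI)
  note [measurable] = h_measurable[of s] T_measurable[of s]
  have M[measurable]: "M \<in> sets (H s)"
    using sets.top[of "H s"] by simp
  fix A assume "A \<in> sets (distr \<nu> \<nu> T)"
  then have A[measurable]: "A \<in> sets (H s)" by (simp add: \<nu>_def)
  have AM: "A \<subseteq> M" using sets.sets_into_space[OF A] by simp
  have TA: "T -` A \<inter> M \<in> sets (H s)"
    using measurable_sets[OF T_measurable A] by simp
  have "emeasure (distr \<nu> \<nu> T) A = emeasure (H s) (T -` A \<inter> M) / emeasure (H s) M"
    using TA unfolding \<nu>_def
    by (subst emeasure_distr) (auto simp: Int_absorb1 Int_commute)
  also have "emeasure (H s) (T -` A \<inter> M) = emeasure (distr (H s) (H s) T) A"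
    by (simp add: emeasure_distr)
  also have "\<dots> = (\<integral>\<^sup>+x. ennreal (exp (s * h x)) * indicator A x \<partial>H s)"
    unfolding distr_hausdorff_measure[OF assms(1,2)] by (intro emeasure_density) auto
  also have "\<dots> = (\<integral>\<^sup>+x. ennreal (exp (s * h x)) * indicator A x * indicator M x \<partial>H s)"
    using AM by (intro nn_integral_cong) (auto split: split_indicator)
  also have "\<dots> / emeasure (H s) M = emeasure (density \<nu> (\<lambda>x. ennreal (exp (s * h x)))) A"
    unfolding \<nu>_def by (subst emeasure_density) (auto simp: nn_integral_uniform_measure)
  finally show "emeasure (distr \<nu> \<nu> T) A = emeasure (density \<nu> (\<lambda>x. ennreal (exp (s * h x)))) A" .
qed simp

lemma RN_deriv_uniform_measure:
  assumes s: "0 \<le> s" and "emeasure (H s) M \<noteq> 0" and "emeasure (H s) M \<noteq> \<infinity>"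
  defines "\<nu> \<equiv> uniform_measure (H s) M"
  shows "AE x in \<nu>. enn2real (RN_deriv \<nu> (distr \<nu> \<nu> T) x) = exp (s * h x)"
proof -
  interpret prob_space \<nu>
    unfolding \<nu>_def using assms(2,3) by (intro prob_space_uniform_measure) auto
  have "(\<lambda>x. ennreal (exp (s * h x))) \<in> borel_measurable \<nu>"
    unfolding \<nu>_def using h_measurable[of s] by simp
  from RN_deriv_unique[OF this distr_uniform_measure[OF assms(1,2), folded \<nu>_def, symmetric]]
  show ?thesis
    by eventually_elim (metis enn2real_ennreal exp_ge_zero)
qed

text \<open>For \<open>x = y\<close> both sides are \<open>0\<close>, also when the exponent is not positive, since \<open>0 powr a = 0\<close>;
  so the identity survives the convention for the integrand on the diagonal.\<close>
lemma conformal_kernel: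
  assumes "x \<in> M" "y \<in> M"
  shows "d (S x) (S y) powr ((1 - 2 * t) * s) =
    exp (s * h x) powr (1/2 - t) * exp (s * h y) powr (1/2 - t) * d x y powr ((1 - 2 * t) * s)"
proof -
  have "exp ((h x + h y) / 2) powr ((1 - 2 * t) * s) = exp (s * h x) powr (1/2 - t) * exp (s * h y) powr (1/2 - t)"
    by (simp add: powr_def flip: exp_add) (simp add: field_simps)
  then show ?thesis
    using assms by (simp add: conformal powr_mult)
qed

text \<open>With \<open>\<rho> = exp (s * h)\<close>, substituting \<open>S y\<close> for \<open>y\<close> in the integral on the right produces the
  Jacobian \<open>\<rho> y\<close>, and the kernel contributes the inverse of
  \<open>\<rho> x powr (1/2 - t) * \<rho> y powr (1/2 - t)\<close>. The factor in \<open>x\<close> cancels against the one in front, and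
  \<open>\<rho> y powr (1 - (1/2 - t))\<close> is the weight on the left. The substitution is an identity of Bochner
  integrals of measurable functions, valid also where they do not converge absolutely and both
  integrals are \<open>0\<close> by convention.\<close>
lemma riesz_potential_conformal:
  fixes v :: "'b \<Rightarrow> complex"
  assumes s: "0 \<le> s" and "emeasure (H s) M \<noteq> 0" and "emeasure (H s) M \<noteq> \<infinity>"
  defines "\<nu> \<equiv> uniform_measure (H s) M"
  defines "\<rho> \<equiv> \<lambda>x. enn2real (RN_deriv \<nu> (distr \<nu> \<nu> T) x)"
  assumes v: "v \<in> borel_measurable \<nu>"
  shows "AE x in \<nu>.
    (LINT y|\<nu>. of_real (\<rho> y powr (1/2 + t)) * v (S y) / of_real (d x y powr ((1 - 2 * t) * s))) =
    of_real (\<rho> x powr (1/2 + - t)) * (LINT y|\<nu>. v y / of_real (d (S x) y powr ((1 - 2 * t) * s)))"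
proof -
  have sets_\<nu>: "sets \<nu> = sets (H s)" and space_\<nu>: "space \<nu> = M"
    by (simp_all add: \<nu>_def)
  note cong = measurable_cong_sets[OF sets_\<nu> refl] measurable_cong_sets[OF refl sets_\<nu>]
  have h[measurable]: "h \<in> borel_measurable \<nu>"
    using h_measurable[of s] by (simp add: cong)
  have S[measurable]: "S \<in> measurable \<nu> \<nu>" and T[measurable]: "T \<in> measurable \<nu> \<nu>"
    using S_measurable[of s] T_measurable[of s] by (simp_all add: cong)
  have \<rho>: "AE x in \<nu>. \<rho> x = exp (s * h x)"
    unfolding \<rho>_def \<nu>_def by (rule RN_deriv_uniform_measure[OF assms(1-3)])
  have dens: "distr \<nu> \<nu> T = density \<nu> (\<lambda>x. ennreal (exp (s * h x)))"
    unfolding \<nu>_def by (rule distr_uniform_measure[OF assms(1,2)])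
  have pointwise: "(LINT y|\<nu>. of_real (\<rho> y powr (1/2 + t)) * v (S y) / of_real (d x y powr ((1 - 2 * t) * s))) =
    of_real (\<rho> x powr (1/2 + - t)) * (LINT y|\<nu>. v y / of_real (d (S x) y powr ((1 - 2 * t) * s)))"
    if x: "x \<in> M" and \<rho>x: "\<rho> x = exp (s * h x)" for x
  proof -
    let ?a = "(1 - 2 * t) * s"
    define k where "k y = v y / of_real (d (S x) y powr ?a)" for y
    have [measurable]: "(\<lambda>y. d x y) \<in> borel_measurable \<nu>" "(\<lambda>y. d (S x) y) \<in> borel_measurable \<nu>"
      using borel_measurable_dist_hausdorff_measure[of _ s] x S_in by (simp_all add: cong)
    have k[measurable]: "k \<in> borel_measurable \<nu>"
      unfolding k_def using v by measurable
    have [measurable]: "\<rho> \<in> borel_measurable \<nu>"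
      unfolding \<rho>_def by measurable
    have "(LINT y|\<nu>. k y) = (LINT y|\<nu>. k (S (T y)))"
      by (intro Bochner_Integration.integral_cong) (auto simp: space_\<nu> S_T)
    also have "\<dots> = (LINT y|distr \<nu> \<nu> T. k (S y))"
      by (rule integral_distr[symmetric]) measurable
    also have "\<dots> = (LINT y|\<nu>. exp (s * h y) *\<^sub>R k (S y))"
      unfolding dens by (rule integral_density) auto
    finally have k_eq: "(LINT y|\<nu>. k y) = (LINT y|\<nu>. exp (s * h y) *\<^sub>R k (S y))" .
    have "of_real (\<rho> x powr (1/2 + - t)) * (LINT y|\<nu>. k y) =
        (LINT y|\<nu>. of_real (\<rho> x powr (1/2 + - t)) * (exp (s * h y) *\<^sub>R k (S y)))"
      unfolding k_eq by (subst integral_mult_right_zero) simp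
    also have "\<dots> = (LINT y|\<nu>. of_real (\<rho> y powr (1/2 + t)) * v (S y) / of_real (d x y powr ?a))"
    proof (rule integral_cong_AE)
      show "AE y in \<nu>. of_real (\<rho> x powr (1/2 + - t)) * (exp (s * h y) *\<^sub>R k (S y)) =
          of_real (\<rho> y powr (1/2 + t)) * v (S y) / of_real (d x y powr ?a)"
        using \<rho> AE_space[of \<nu>]
      proof eventually_elim
        case (elim y)
        then have y: "y \<in> M" by (simp add: space_\<nu>)
        let ?e = "\<lambda>x. exp (s * h x)"
        have split: "?e y = ?e y powr (1/2 + t) * ?e y powr (1/2 - t)"
          by (simp flip: powr_add)
        have "?e x powr (1/2 - t) * (?e y / d (S x) (S y) powr ?a) = ?e y powr (1/2 + t) / d x y powr ?a"
          unfolding conformal_kernel[OF x y] by (subst split) (simp add: field_simps)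
        then have "complex_of_real (?e x powr (1/2 - t) * (?e y / d (S x) (S y) powr ?a)) * v (S y) =
            of_real (?e y powr (1/2 + t) / d x y powr ?a) * v (S y)"
          by simp
        then show ?case
          unfolding k_def elim(1) \<rho>x by (simp add: scaleR_conv_of_real mult_ac)
      qed
    qed (use v in measurable)
    finally show ?thesis unfolding k_def by simp
  qed
  show ?thesis
    using \<rho> AE_space[of \<nu>]
  proof eventually_elim
    case (elim x)
    then show ?case using pointwise by (simp only: space_\<nu>)
  qed
qed

end

section \<open>The Gromov boundary under isometries\<close>

text \<open>Logarithms of natural numbers are nonnegative, including the conventional value \<open>ln 0 = 0\<close>, and
  an infinite growth rate is turned into \<open>0\<close>.\<close>
lemma conformal_dim_nonneg:
  fixes x0 :: "'a::metric_space"
  assumes "0 < \<epsilon>"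
  shows "0 \<le> conformal_dim G \<phi> x0 \<epsilon>"
proof -
  let ?f = "\<lambda>r::real. ereal (ln (real (card (orbit G \<phi> x0 \<inter> ball x0 r))) / r)"
  have "0 \<le> ln (real n)" for n
    by (cases n) auto
  then have "eventually (\<lambda>r. 0 \<le> ?f r) at_top"
    by (intro eventually_mono[OF eventually_gt_at_top[of 0]]) simp
  then have "Limsup at_top (\<lambda>r::real. 0) \<le> Limsup at_top ?f"
    by (rule Limsup_mono)
  then have "0 \<le> Limsup at_top ?f"
    by (simp add: Limsup_const)
  then show ?thesis
    using assms by (simp add: conformal_dim_def growth_exponent_def real_of_ereal_pos)
qed

lemma asymptotic_iff:
  "asymptotic x0 s t \<longleftrightarrow>
    (\<forall>R. \<exists>N. \<forall>i\<ge>N. \<forall>j\<ge>N. R \<le> gromov_product dist x0 (s i) (t j))"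
  unfolding asymptotic_def filterlim_at_top eventually_prod_sequentially prod.case by blast

lemma gromov_boundary_memberD:
  assumes "\<xi> \<in> gromov_boundary x0" and "s \<in> \<xi>"
  shows "asymptotic x0 s s"
  using assms by (auto simp: gromov_boundary_def quotient_def gromov_sequences_def)

lemma gromov_boundary_nonempty:
  assumes "\<xi> \<in> gromov_boundary x0"
  obtains s where "s \<in> \<xi>"
  using assms by (auto simp: gromov_boundary_def quotient_def gromov_sequences_def)

lemma topspace_bordification: "topspace (bordification_topology x0) = bordification x0"
proof -
  have "openin (bordification_topology x0) (bordification x0)"
    unfolding openin_bordification_topology bordification_open_def
    by (simp add: bordification_def InlI vimage_def)
  moreover have "U \<subseteq> bordification x0" if "openin (bordification_topology x0) U" for U
    using that by (simp add: openin_bordification_topology bordification_open_def)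
  ultimately show ?thesis
    by (metis openin_subset openin_topspace subset_antisym)
qed

text \<open>A basic neighbourhood of \<open>\<xi>\<close> contains all points whose rough product with \<open>\<xi>\<close> is large, and this
  product is bounded below by testing with \<open>s\<close> itself, whose Gromov products with its own late terms
  are large.\<close>
lemma limitin_bordification_approximant:
  assumes "\<xi> \<in> gromov_boundary x0" and "s \<in> \<xi>"
  shows "limitin (bordification_topology x0) (\<lambda>n. Inl (s n)) (Inr \<xi>) sequentially"
  unfolding limitin_def topspace_bordification openin_bordification_topology
proof (intro conjI allI impI)
  show "Inr \<xi> \<in> bordification x0"
    using assms by (simp add: bordification_def InrI)
  fix U assume U: "bordification_open x0 U \<and> Inr \<xi> \<in> U"
  then obtain R :: real where R: "{b \<in> bordification x0. ereal R < rough_product x0 (Inr \<xi>) b} \<subseteq> U"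
    unfolding bordification_open_def by blast
  from gromov_boundary_memberD[OF assms] obtain N where
    N: "\<And>i j. i \<ge> N \<Longrightarrow> j \<ge> N \<Longrightarrow> R + 1 \<le> gromov_product dist x0 (s i) (s j)"
    unfolding asymptotic_iff by meson
  have "Inl (s n) \<in> U" if "n \<ge> N" for n
  proof -
    have "ereal R < ereal (R + 1)" by simp
    also have "\<dots> \<le> Liminf (sequentially \<times>\<^sub>F sequentially)
        (\<lambda>(i, j). ereal (gromov_product dist x0 (s i) (s n)))"
    proof (rule Liminf_bounded)
      show "\<forall>\<^sub>F p in sequentially \<times>\<^sub>F sequentially.
          ereal (R + 1) \<le> (case p of (i, j) \<Rightarrow> ereal (gromov_product dist x0 (s i) (s n)))"
        unfolding eventually_prod_sequentially using N that by auto
    qed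
    also have "\<dots> \<le> rough_product x0 (Inr \<xi>) (Inl (s n))"
      unfolding rough_product_def approximants.simps
      by (rule SUP_upper2[OF assms(2)]) simp
    finally have "ereal R < rough_product x0 (Inr \<xi>) (Inl (s n))" .
    then show ?thesis
      using R by (auto simp: bordification_def)
  qed
  then show "\<forall>\<^sub>F n in sequentially. Inl (s n) \<in> U"
    unfolding eventually_sequentially by blast
qed

lemma limitin_bordification_point:
  "limitin (bordification_topology x0) (\<lambda>n. Inl x) (Inl x) sequentially"
  by (simp add: limitin_const topspace_bordification bordification_def InlI)

lemma extended_product_tendsto:
  assumes "\<exists>F. continuous_extension x0 p F"
    and "limitin (bordification_topology x0) (\<lambda>n. Inl (s n)) a sequentially"
    and "limitin (bordification_topology x0) (\<lambda>n. Inl (u n)) b sequentially"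
  shows "(\<lambda>n. ereal (gromov_product dist p (s n) (u n))) \<longlonglongrightarrow> extended_product x0 p a b"
proof -
  let ?F = "extended_product x0 p"
  have F: "continuous_extension x0 p ?F"
    unfolding extended_product_def using assms(1) by (rule someI_ex)
  have "limitin (prod_topology (bordification_topology x0) (bordification_topology x0))
      (\<lambda>n. (Inl (s n), Inl (u n))) (a, b) sequentially"
    using assms(2,3) by (simp add: limitin_pairwise o_def)
  with F have "limitin euclidean ((\<lambda>(a, b). ?F a b) \<circ> (\<lambda>n. (Inl (s n), Inl (u n))))
      ((\<lambda>(a, b). ?F a b) (a, b)) sequentially"
    unfolding continuous_extension_def by (blast intro: continuous_map_limit)
  then show ?thesis
    using F by (simp add: o_def continuous_extension_def)
qed

text \<open>The product of \<open>x\<close> and \<open>y\<close> based at \<open>p\<close> is the product of their images based at \<open>f p\<close>, and moving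
  the basepoint to \<open>p\<close> changes a Gromov product by at most the distance moved.\<close>
lemma gromov_product_isometry:
  assumes "\<And>x y. dist (f x) (f y) = dist x y"
  shows "\<bar>gromov_product dist p (f x) (f y) - gromov_product dist p x y\<bar> \<le> dist (f p) p"
proof -
  have "\<bar>dist (f z) p - dist z p\<bar> \<le> dist (f p) p" for z
    using assms[of z p] dist_triangle[of "f z" p "f p"] dist_triangle[of "f z" "f p" p]
    by (simp add: dist_commute)
  from this[of x] this[of y] show ?thesis
    unfolding gromov_product_def assms by argo
qed

lemma asymptotic_isometry:
  assumes f: "\<And>x y. dist (f x) (f y) = dist x y"
  shows "asymptotic x0 (f \<circ> s) (f \<circ> t) \<longleftrightarrow> asymptotic x0 s t"
proof -
  have *: "gromov_product dist x0 (f x) (f y) \<le> gromov_product dist x0 x y + dist (f x0) x0"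
    "gromov_product dist x0 x y \<le> gromov_product dist x0 (f x) (f y) + dist (f x0) x0" for x y
    using gromov_product_isometry[of f x0 x y, OF f] by linarith+
  show ?thesis
    unfolding asymptotic_iff o_def
  proof (intro iffI allI)
    fix R assume "\<forall>R. \<exists>N. \<forall>i\<ge>N. \<forall>j\<ge>N. R \<le> gromov_product dist x0 (f (s i)) (f (t j))"
    then obtain N where "\<forall>i\<ge>N. \<forall>j\<ge>N. R + dist (f x0) x0 \<le> gromov_product dist x0 (f (s i)) (f (t j))"
      by blast
    then show "\<exists>N. \<forall>i\<ge>N. \<forall>j\<ge>N. R \<le> gromov_product dist x0 (s i) (t j)"
      using *(1) by (meson add_le_cancel_right order_trans)
  next
    fix R assume "\<forall>R. \<exists>N. \<forall>i\<ge>N. \<forall>j\<ge>N. R \<le> gromov_product dist x0 (s i) (t j)"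
    then obtain N where "\<forall>i\<ge>N. \<forall>j\<ge>N. R + dist (f x0) x0 \<le> gromov_product dist x0 (s i) (t j)"
      by blast
    then show "\<exists>N. \<forall>i\<ge>N. \<forall>j\<ge>N. R \<le> gromov_product dist x0 (f (s i)) (f (t j))"
      using *(2) by (meson add_le_cancel_right order_trans)
  qed
qed

lemma boundary_action_in:
  assumes f: "\<And>x y. dist (f x) (f y) = dist x y" and "surj f" and \<xi>: "\<xi> \<in> gromov_boundary x0"
  shows "boundary_action f \<xi> \<in> gromov_boundary x0"
proof -
  note iso = asymptotic_isometry[of f x0, OF f]
  from \<xi> obtain s where s: "asymptotic x0 s s"
      and \<xi>_eq: "\<xi> = {t. asymptotic x0 t t \<and> asymptotic x0 s t}"
    by (auto simp: gromov_boundary_def quotient_def gromov_sequences_def)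
  have "boundary_action f \<xi> = {t. asymptotic x0 t t \<and> asymptotic x0 (f \<circ> s) t}"
  proof (intro equalityI subsetI)
    fix t assume t: "t \<in> {t. asymptotic x0 t t \<and> asymptotic x0 (f \<circ> s) t}"
    have "t = f \<circ> (inv_into UNIV f \<circ> t)"
      using \<open>surj f\<close> by (auto simp: o_def surj_f_inv_f)
    then show "t \<in> boundary_action f \<xi>"
      using t iso unfolding boundary_action_def \<xi>_eq by (metis (mono_tags, lifting) imageI mem_Collect_eq)
  qed (auto simp: boundary_action_def \<xi>_eq iso)
  moreover have "asymptotic x0 (f \<circ> s) (f \<circ> s)" using s iso by simp
  ultimately show ?thesis
    by (auto simp: gromov_boundary_def quotient_def gromov_sequences_def)
qed

lemma boundary_action_comp:
  "boundary_action f (boundary_action k \<xi>) = boundary_action (f \<circ> k) \<xi>"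
  by (simp add: boundary_action_def image_image o_assoc)

lemma boundary_action_id: "boundary_action id \<xi> = \<xi>"
  by (simp add: boundary_action_def)

text \<open>The limit of \<open>dist z x0 - dist z p\<close> as \<open>z\<close> tends to \<open>\<xi>\<close>, that is \<open>\<beta>\<^sub>\<xi>(x0, p)\<close>. Up to a constant and
  a factor of \<open>2\<close> the difference is the Gromov product of \<open>z\<close> and \<open>p\<close> based at \<open>x0\<close>, whose continuous
  extension therefore supplies the limit.\<close>
definition busemann :: "'a::metric_space \<Rightarrow> 'a \<Rightarrow> (nat \<Rightarrow> 'a) set \<Rightarrow> real" where
  "busemann x0 p \<xi> = 2 * real_of_ereal (extended_product x0 x0 (Inr \<xi>) (Inl p)) - dist p x0"

lemma gromov_product_bounds: "0 \<le> gromov_product dist p x y" "gromov_product dist p x y \<le> dist y p"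
  unfolding gromov_product_def
  using dist_triangle[of x y p] dist_triangle[of x p y] by (simp_all add: dist_commute)

context
  fixes x0 :: "'a::metric_space"
  assumes ext: "\<exists>F. continuous_extension x0 x0 F"
begin

text \<open>The extended product of a boundary point and an interior point is finite, because Gromov
  products with \<open>p\<close> are at most \<open>dist p x0\<close>.\<close>
lemma busemann_tendsto:
  assumes "\<xi> \<in> gromov_boundary x0" "s \<in> \<xi>"
  shows "(\<lambda>n. dist (s n) x0 - dist (s n) p) \<longlonglongrightarrow> busemann x0 p \<xi>"
proof -
  let ?F = "extended_product x0 x0 (Inr \<xi>) (Inl p)"
  have lim: "(\<lambda>n. ereal (gromov_product dist x0 (s n) p)) \<longlonglongrightarrow> ?F"
    using extended_product_tendsto[OF ext limitin_bordification_approximant[OF assms] limitin_bordification_point] .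
  have "0 \<le> ?F"
    by (rule LIMSEQ_le_const[OF lim]) (simp add: gromov_product_bounds)
  moreover have "?F \<le> ereal (dist p x0)"
    by (rule LIMSEQ_le_const2[OF lim]) (simp add: gromov_product_bounds)
  ultimately have F: "ereal (real_of_ereal ?F) = ?F"
    by (cases ?F) auto
  with lim have "(\<lambda>n. ereal (gromov_product dist x0 (s n) p)) \<longlonglongrightarrow> ereal (real_of_ereal ?F)"
    by simp
  then have "(\<lambda>n. gromov_product dist x0 (s n) p) \<longlonglongrightarrow> real_of_ereal ?F"
    by simp
  then have "(\<lambda>n. 2 * gromov_product dist x0 (s n) p - dist p x0) \<longlonglongrightarrow> busemann x0 p \<xi>"
    unfolding busemann_def by (intro tendsto_intros)
  then show ?thesis
    by (simp add: gromov_product_def add_divide_distrib diff_divide_distrib)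
qed

lemma busemann_bounded:
  assumes "\<xi> \<in> gromov_boundary x0"
  shows "\<bar>busemann x0 p \<xi>\<bar> \<le> dist p x0"
proof -
  obtain s where s: "s \<in> \<xi>" using assms by (rule gromov_boundary_nonempty)
  have "(\<lambda>n. \<bar>dist (s n) x0 - dist (s n) p\<bar>) \<longlonglongrightarrow> \<bar>busemann x0 p \<xi>\<bar>"
    by (intro tendsto_rabs busemann_tendsto[OF assms s])
  moreover have "\<bar>dist (s n) x0 - dist (s n) p\<bar> \<le> dist p x0" for n
    using dist_triangle[of "s n" x0 p] dist_triangle[of "s n" p x0] by (simp add: dist_commute)
  ultimately show ?thesis
    by (intro LIMSEQ_le_const2) auto
qed

text \<open>The corresponding identity for points of the space is an elementary computation, since
  \<open>dist (f x) x0 = dist x p\<close>. It passes to the limit along sequences that represent \<open>\<xi>\<close> and \<open>\<eta>\<close>; the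
  Busemann terms are finite, so the limit makes sense even if the product of \<open>\<xi>\<close> and \<open>\<eta>\<close> is
  infinite.\<close>
lemma extended_product_boundary_action:
  assumes f: "\<And>x y. dist (f x) (f y) = dist x y" and "surj f" and p: "f p = x0"
    and \<xi>: "\<xi> \<in> gromov_boundary x0" and \<eta>: "\<eta> \<in> gromov_boundary x0"
  shows "extended_product x0 x0 (Inr (boundary_action f \<xi>)) (Inr (boundary_action f \<eta>)) =
    extended_product x0 x0 (Inr \<xi>) (Inr \<eta>) - ereal ((busemann x0 p \<xi> + busemann x0 p \<eta>) / 2)"
proof -
  obtain s u where s: "s \<in> \<xi>" and u: "u \<in> \<eta>"
    using gromov_boundary_nonempty[OF \<xi>] gromov_boundary_nonempty[OF \<eta>] by metis
  have fs: "f \<circ> s \<in> boundary_action f \<xi>" and fu: "f \<circ> u \<in> boundary_action f \<eta>"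
    using s u by (auto simp: boundary_action_def)
  have "(\<lambda>n. ereal (gromov_product dist x0 (s n) (u n)) -
        ereal (((dist (s n) x0 - dist (s n) p) + (dist (u n) x0 - dist (u n) p)) / 2)) \<longlonglongrightarrow>
      extended_product x0 x0 (Inr \<xi>) (Inr \<eta>) - ereal ((busemann x0 p \<xi> + busemann x0 p \<eta>) / 2)"
    by (intro tendsto_diff_ereal_general tendsto_ereal tendsto_divide tendsto_add tendsto_const
        busemann_tendsto[OF \<xi> s] busemann_tendsto[OF \<eta> u]
        extended_product_tendsto[OF ext limitin_bordification_approximant[OF \<xi> s]
          limitin_bordification_approximant[OF \<eta> u]]) auto
  moreover have "ereal (gromov_product dist x0 (f (s n)) (f (u n))) =
      ereal (gromov_product dist x0 (s n) (u n)) -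
      ereal (((dist (s n) x0 - dist (s n) p) + (dist (u n) x0 - dist (u n) p)) / 2)" for n
    using f[of "s n" p] f[of "u n" p] f[of "s n" "u n"] p by (simp add: gromov_product_def field_simps)
  moreover have "(\<lambda>n. ereal (gromov_product dist x0 ((f \<circ> s) n) ((f \<circ> u) n))) \<longlonglongrightarrow>
      extended_product x0 x0 (Inr (boundary_action f \<xi>)) (Inr (boundary_action f \<eta>))"
    using boundary_action_in[OF f \<open>surj f\<close>] \<xi> \<eta> fs fu
    by (intro extended_product_tendsto[OF ext] limitin_bordification_approximant)
  ultimately show ?thesis
    by (auto intro: LIMSEQ_unique)
qed

lemma visual_dist_boundary_action:
  assumes f: "\<And>x y. dist (f x) (f y) = dist x y" and "surj f" and p: "f p = x0"
    and \<xi>: "\<xi> \<in> gromov_boundary x0" and \<eta>: "\<eta> \<in> gromov_boundary x0"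
  shows "visual_dist x0 x0 \<epsilon> (boundary_action f \<xi>) (boundary_action f \<eta>) =
    exp ((\<epsilon> * busemann x0 p \<xi> + \<epsilon> * busemann x0 p \<eta>) / 2) * visual_dist x0 x0 \<epsilon> \<xi> \<eta>"
proof -
  obtain s u where s: "s \<in> \<xi>" and u: "u \<in> \<eta>"
    using gromov_boundary_nonempty[OF \<xi>] gromov_boundary_nonempty[OF \<eta>] by metis
  \<comment> \<open>The value \<open>-\<infinity>\<close> has to be excluded: its real part is \<open>0\<close>, so both distances would be \<open>1\<close>
    and could not scale.\<close>
  have "0 \<le> extended_product x0 x0 (Inr \<xi>) (Inr \<eta>)"
    by (rule LIMSEQ_le_const[OF extended_product_tendsto[OF ext
          limitin_bordification_approximant[OF \<xi> s] limitin_bordification_approximant[OF \<eta> u]]])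
       (simp add: gromov_product_bounds)
  then show ?thesis
    using \<xi> \<eta> boundary_action_in[OF f \<open>surj f\<close>]
    unfolding visual_dist_def extended_product_boundary_action[OF f \<open>surj f\<close> p \<xi> \<eta>]
    by (cases "extended_product x0 x0 (Inr \<xi>) (Inr \<eta>)") (auto simp: field_simps simp flip: exp_add)
qed

end

section \<open>The intertwining relation\<close>

text \<open>Dividing by an infinite mass gives density \<open>0\<close>, and no density makes a null measure nonzero, so
  the normalized measure is null in both cases.\<close>
lemma AE_uniform_measure_trivial:
  assumes "emeasure H (space H) = 0 \<or> emeasure H (space H) = \<infinity>"
  shows "AE x in uniform_measure H (space H). P x"
proof -
  have "emeasure (uniform_measure H (space H)) (space H) = 0"
    using assms by auto
  then have "space H \<in> null_sets (uniform_measure H (space H))"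
    by (simp add: null_setsI)
  then show ?thesis
    by (rule AE_I') auto
qed

theorem proposition3p17:
  fixes x0 :: "'a::metric_space"
    and \<epsilon> t :: real
    and G :: "('g, 'm) monoid_scheme"
    and \<phi> :: "'g \<Rightarrow> 'a \<Rightarrow> 'a"
  assumes proper: "\<And>(x::'a) r. compact (cball x r)"
    and hyperbolic: "hyperbolic_at (UNIV :: 'a set) dist x0"
    and roughly_geodesic: "roughly_geodesic (UNIV :: 'a set) dist"
    and "\<epsilon> > 0"
    and good: "good_space x0 \<epsilon>"
    and group_hyperbolic: "hyperbolic_group G"
    and non_elementary: "non_elementary G"
    and action: "geometric_action G \<phi>"
    and "t > 0"
  shows "\<forall>g\<in>carrier G. \<forall>v. square_integrable (boundary_measure G \<phi> x0 \<epsilon>) v \<longrightarrow>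
    (AE \<xi> in boundary_measure G \<phi> x0 \<epsilon>.
       intertwiner G \<phi> x0 \<epsilon> t (boundary_rep G \<phi> x0 \<epsilon> t g v) \<xi> =
       boundary_rep G \<phi> x0 \<epsilon> (- t) g (intertwiner G \<phi> x0 \<epsilon> t v) \<xi>)"
proof (intro ballI allI impI)
  fix g v
  assume g: "g \<in> carrier G" and v: "square_integrable (boundary_measure G \<phi> x0 \<epsilon>) v"
  let ?M = "gromov_boundary x0" and ?d = "visual_dist x0 x0 \<epsilon>" and ?D = "conformal_dim G \<phi> x0 \<epsilon>"
  let ?H = "hausdorff_measure ?M ?d ?D" and ?\<nu> = "boundary_measure G \<phi> x0 \<epsilon>"
  have \<nu>: "?\<nu> = uniform_measure ?H ?M"
    by (simp add: boundary_measure_def)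
  show "AE \<xi> in ?\<nu>. intertwiner G \<phi> x0 \<epsilon> t (boundary_rep G \<phi> x0 \<epsilon> t g v) \<xi> =
       boundary_rep G \<phi> x0 \<epsilon> (- t) g (intertwiner G \<phi> x0 \<epsilon> t v) \<xi>"
  proof (cases "emeasure ?H ?M = 0 \<or> emeasure ?H ?M = \<infinity>")
    case True
    then show ?thesis
      using AE_uniform_measure_trivial[of ?H] unfolding \<nu> space_hausdorff_measure by blast
  next
    case False
    interpret group_action G UNIV \<phi>
      using action by (simp add: geometric_action_def)
    interpret group G
      using group_hom by (simp add: group_hom_def)
    have isometry: "dist (\<phi> k x) (\<phi> k y) = dist x y" if "k \<in> carrier G" for k x y
      using action that by (simp add: geometric_action_def)
    have surj: "surj (\<phi> k)" if "k \<in> carrier G" for k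
      using surj_prop[OF that] .
    let ?f = "\<phi> (inv\<^bsub>G\<^esub> g)"
    have g': "inv\<^bsub>G\<^esub> g \<in> carrier G" using g by simp
    have inv: "\<phi> g (?f x) = x" "?f (\<phi> g x) = x" for x
      using orbit_sym_aux[OF g, of x] orbit_sym_aux[OF g', of x] g by auto
    have comp: "\<phi> g \<circ> ?f = id" "?f \<circ> \<phi> g = id"
      by (simp_all add: fun_eq_iff inv)
    have ext: "\<exists>F. continuous_extension x0 x0 F"
      using good by (simp add: good_space_def)
    interpret conformal_bijection ?M ?d "boundary_action ?f" "boundary_action (\<phi> g)"
      "\<lambda>\<xi>. \<epsilon> * busemann x0 (\<phi> g x0) \<xi>" "\<epsilon> * dist (\<phi> g x0) x0"
    proof (intro conformal_bijection.intro conformal_bijection_axioms.intro)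
      show "Metric_space ?M ?d"
        using good by (simp add: good_space_def)
    next
      fix \<xi> \<eta> assume \<xi>: "\<xi> \<in> ?M" and \<eta>: "\<eta> \<in> ?M"
      show "?d (boundary_action ?f \<xi>) (boundary_action ?f \<eta>) =
          exp ((\<epsilon> * busemann x0 (\<phi> g x0) \<xi> + \<epsilon> * busemann x0 (\<phi> g x0) \<eta>) / 2) * ?d \<xi> \<eta>"
        by (rule visual_dist_boundary_action[OF ext isometry[OF g'] surj[OF g'] inv(2) \<xi> \<eta>])
    qed (use isometry[OF g] isometry[OF g'] surj[OF g] surj[OF g'] \<open>\<epsilon> > 0\<close> in
      \<open>auto simp: boundary_action_in boundary_action_comp comp boundary_action_id abs_mult
        busemann_bounded[OF ext]\<close>)
    have v: "v \<in> borel_measurable (uniform_measure ?H ?M)"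
      using v by (simp add: square_integrable_def \<nu>)
    show ?thesis
      unfolding intertwiner_def boundary_rep_def Let_def \<nu>
      by (rule riesz_potential_conformal[OF conformal_dim_nonneg[OF \<open>\<epsilon> > 0\<close>] _ _ v])
         (use False in auto)
  qed
qed

end
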